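(* Let $G_0=(\mathcal N_0,\mathcal A_0)$ be a connected finite simple undirected graph with $N_0=|\mathcal N_0|\ge 3$ nodes, with designated nodes $h^{start},h^{end}\in\mathcal N_0$ chosen as described in the context, and let $\alpha_1,\alpha_2>0$. Let $\widetilde{\mathcal L}:[0,1]^{|\mathcal A_0|}\to\mathbb R$ be the total objective and $\mathcal T_{HP}\subset\{0,1\}^{|\mathcal A_0|}$ the target set defined in the context. If $G_0$ has a Hamiltonian path from $h^{start}$ to $h^{end}$, then every global minimizer of $\widetilde{\mathcal L}$ over $[0,1]^{|\mathcal A_0|}$ belongs to $\mathcal T_{HP}$.
   Context: A Hamiltonian path in a graph is a path containing every node exactly once. "Arc" means undirected edge $\{i,j\}$ unless written as an ordered pair $(i,j)$. Designated nodes and augmented graph. $G_0=(\mathcal N_0,\mathcal A_0)$ is a connected finite simple undirected graph with $|\mathcal N_0|\ge 3$ and at most two nodes of degree $1$ (if it has more than two, it has no Hamiltonian path and the construction is not made). Two distinct nodes $h^{start},h^{end}\in\mathcal N_0$ are designated, and an augmented graph $G=(\mathcal N,\mathcal A)$ with terminals $v^{IN},v^{OUT}\in\mathcal N$ is defined as follows. (1) If $G_0$ has exactly two nodes of degree $1$, then $h^{start},h^{end}$ are these two nodes (in either order), $v^{IN}=h^{start}$, $v^{OUT}=h^{end}$, $\mathcal N=\mathcal N_0$, $\mathcal A=\mathcal A_0$. (2) If $G_0$ has exactly one node of degree $1$, then $h^{start}$ is that node, $h^{end}$ is chosen arbitrarily, $v^{IN}=h^{start}$, $v^{OUT}\notin\mathcal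 N_0$ is a new node, $\mathcal N=\mathcal N_0\cup\{v^{OUT}\}$, $\mathcal A=\mathcal A_0\cup\{\{h^{end},v^{OUT}\}\}$. (3) If $G_0$ has no node of degree $1$, then $h^{start},h^{end}$ are chosen arbitrarily, $v^{IN},v^{OUT}\notin\mathcal N_0$ are two new nodes, $\mathcal N=\mathcal N_0\cup\{v^{IN},v^{OUT}\}$, $\mathcal A=\mathcal A_0\cup\{\{v^{IN},h^{start}\},\{h^{end},v^{OUT}\}\}$. Put $N=|\mathcal N|$. By convention, if $\{v^{IN},v^{OUT}\}\in\mathcal A_0$ its conductance is fixed at $0$ (this does not occur under the assumptions above, since $G_0$ is connected with at least $3$ nodes). Conductances. A conductance configuration is $g=(g_a)_{a\in\mathcal A_0}\in[0,1]^{|\mathcal A_0|}$. The effective conductances are $\tilde g_a=g_a$ for $a\in\mathcal A_0$ and $\tilde g_a=1$ for $a\in\mathcal A\setminus\mathcal A_0$. The conducting subgraph of $g$ is $(\mathcal N,\{a\in\mathcal A:\tilde g_a>0\})$. Potentials. If $v^{IN}$ and $v^{OUT}$ lie in the same connected component of the conducting subgraph, with node set $\mathcal N_P$, then $(\phi_i(g))_{i\in\mathcal N_P}$ is the unique solution of $$\sum_{j:\{i,j\}\in\mathcal A}\tilde g_{\{i,j\}}(\phi_i(g)-\phi_j(g))=0,\quad i\in\mathcal N_P\setminus\{v^{IN},v^{OUT}\},\qquad \phi_{v^{IN}}(g)=N-1,\ \phi_{v^{OUT}}(g)=0.$$ For every node $i$ in a connected component of the conducting subgraph that does not contain both $v^{IN}$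 and $v^{OUT}$, set $\phi_i(g)=0$. Currents. For $\{i,j\}\in\mathcal A$ the directed current is $J_{(i,j)}(g)=\tilde g_{\{i,j\}}(\phi_i(g)-\phi_j(g))$, so that $J_{(i,j)}=-J_{(j,i)}$. Objective. With $s^+=\max\{s,0\}$, for $i\in\mathcal N$ define $$O_i(g)=\sum_{j:\{i,j\}\in\mathcal A}(J_{(i,j)}(g))^+,\qquad \mathcal L_{\mathrm{outflow}}(g)=O_{v^{OUT}}(g)^2+\sum_{i\in\mathcal N,\ i\ne v^{OUT}}(O_i(g)-1)^2,$$ $$B_i(g)=\sum_{1\le k<\ell\le d_i}(J_{(i,j_k)}(g))^+(J_{(i,j_\ell)}(g))^+,\qquad \mathcal L_{\mathrm{branch}}(g)=\sum_{i\in\mathcal N}B_i(g),$$ where $j_1,\dots,j_{d_i}$ are the neighbors of $i$ in $G$. The total objective is $\widetilde{\mathcal L}(g)=\alpha_1\mathcal L_{\mathrm{outflow}}(g)+\alpha_2\mathcal L_{\mathrm{branch}}(g)$, with fixed constants $\alpha_1,\alpha_2>0$. Target set. $\mathcal T_{HP}$ is the set of all $g\in\{0,1\}^{|\mathcal A_0|}$ such that $\{a\in\mathcal A_0:g_a=1\}\cup(\mathcal A\setminus\mathcal A_0)$ is the arc set of a Hamiltonian path from $v^{IN}$ to $v^{OUT}$ in $G$. *)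

theory Defs
  imports Complex_Main "HOL-Library.FuncSet"
begin

text \<open>A finite simple undirected graph is a node set \<open>N\<close> together with a set \<open>A\<close> of
  arcs, an arc being a two-element set of nodes.\<close>

definition simple_graph :: "'a set \<Rightarrow> 'a set set \<Rightarrow> bool" where
  "simple_graph N A \<longleftrightarrow> finite N \<and> (\<forall>a\<in>A. a \<subseteq> N \<and> card a = 2)"

definition adjacency :: "'a set set \<Rightarrow> ('a \<times> 'a) set" where
  "adjacency A = {(i, j). {i, j} \<in> A}"

definition connected_graph :: "'a set \<Rightarrow> 'a set set \<Rightarrow> bool" where
  "connected_graph N A \<longleftrightarrow> N \<noteq> {} \<and> (\<forall>i\<in>N. \<forall>j\<in>N. (i, j) \<in> (adjacency A)\<^sup>*)"

definition neighbors :: "'a set set \<Rightarrow> 'a \<Rightarrow> 'a set" where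
  "neighbors A i = {j. {i, j} \<in> A}"

definition degree :: "'a set set \<Rightarrow> 'a \<Rightarrow> nat" where
  "degree A i = card (neighbors A i)"

definition degree_one_nodes :: "'a set \<Rightarrow> 'a set set \<Rightarrow> 'a set" where
  "degree_one_nodes N A = {i \<in> N. degree A i = 1}"

definition hamiltonian_path :: "'a set \<Rightarrow> 'a set set \<Rightarrow> 'a \<Rightarrow> 'a \<Rightarrow> 'a list \<Rightarrow> bool" where
  "hamiltonian_path N A u v p \<longleftrightarrow>
     p \<noteq> [] \<and> hd p = u \<and> last p = v \<and> distinct p \<and> set p = N \<and>
     successively (\<lambda>i j. {i, j} \<in> A) p"

definition path_arcs :: "'a list \<Rightarrow> 'a set set" where
  "path_arcs p = {{p ! k, p ! Suc k} | k. Suc k < length p}"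

text \<open>\<open>augmentation N0 A0 hs he N A vin vout\<close>: the nodes \<open>hs\<close>, \<open>he\<close> are an admissible
  choice of designated nodes of \<open>(N0, A0)\<close>, and \<open>(N, A)\<close> with terminals \<open>vin\<close>, \<open>vout\<close> is
  a corresponding augmented graph. New terminals may be any nodes outside \<open>N0\<close>. No rule
  applies if \<open>(N0, A0)\<close> has more than two nodes of degree one.\<close>

inductive augmentation ::
  "'a set \<Rightarrow> 'a set set \<Rightarrow> 'a \<Rightarrow> 'a \<Rightarrow> 'a set \<Rightarrow> 'a set set \<Rightarrow> 'a \<Rightarrow> 'a \<Rightarrow> bool"
  for N0 :: "'a set" and A0 :: "'a set set" and hs he :: 'a
where
  two: "\<lbrakk>hs \<in> N0; he \<in> N0; hs \<noteq> he; degree_one_nodes N0 A0 = {hs, he}\<rbrakk>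
    \<Longrightarrow> augmentation N0 A0 hs he N0 A0 hs he"
| one: "\<lbrakk>hs \<in> N0; he \<in> N0; hs \<noteq> he; degree_one_nodes N0 A0 = {hs}; vout \<notin> N0\<rbrakk>
    \<Longrightarrow> augmentation N0 A0 hs he (insert vout N0) (insert {he, vout} A0) hs vout"
| none: "\<lbrakk>hs \<in> N0; he \<in> N0; hs \<noteq> he; degree_one_nodes N0 A0 = {};
      vin \<notin> N0; vout \<notin> N0; vin \<noteq> vout\<rbrakk>
    \<Longrightarrow> augmentation N0 A0 hs he (N0 \<union> {vin, vout})
          (A0 \<union> {{vin, hs}, {he, vout}}) vin vout"

definition conductance_configs :: "'a set set \<Rightarrow> ('a set \<Rightarrow> real) set" where
  "conductance_configs A0 = A0 \<rightarrow>\<^sub>E {0..1}"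

locale circuit =
  fixes N :: "'a set" and A A0 :: "'a set set" and vin vout :: 'a
begin

definition eff_conductance :: "('a set \<Rightarrow> real) \<Rightarrow> 'a set \<Rightarrow> real" where
  "eff_conductance g a = (if a \<in> A0 then g a else 1)"

definition conducting_arcs :: "('a set \<Rightarrow> real) \<Rightarrow> 'a set set" where
  "conducting_arcs g = {a \<in> A. eff_conductance g a > 0}"

definition conducting_component :: "('a set \<Rightarrow> real) \<Rightarrow> 'a \<Rightarrow> 'a set" where
  "conducting_component g i = {j \<in> N. (i, j) \<in> (adjacency (conducting_arcs g))\<^sup>*}"

definition is_potential :: "('a set \<Rightarrow> real) \<Rightarrow> ('a \<Rightarrow> real) \<Rightarrow> bool" where
  "is_potential g \<phi> \<longleftrightarrow>
     (\<forall>i \<in> conducting_component g vin - {vin, vout}.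
        (\<Sum>j\<in>neighbors A i. eff_conductance g {i, j} * (\<phi> i - \<phi> j)) = 0) \<and>
     \<phi> vin = real (card N) - 1 \<and> \<phi> vout = 0 \<and>
     (\<forall>i. i \<notin> conducting_component g vin \<longrightarrow> \<phi> i = 0)"

definition potential :: "('a set \<Rightarrow> real) \<Rightarrow> 'a \<Rightarrow> real" where
  "potential g =
     (if vout \<in> conducting_component g vin then (THE \<phi>. is_potential g \<phi>) else (\<lambda>_. 0))"

definition current :: "('a set \<Rightarrow> real) \<Rightarrow> 'a \<Rightarrow> 'a \<Rightarrow> real" where
  "current g i j = eff_conductance g {i, j} * (potential g i - potential g j)"

definition outflow :: "('a set \<Rightarrow> real) \<Rightarrow> 'a \<Rightarrow> real" where
  "outflow g i = (\<Sum>j\<in>neighbors A i. max (current g i j) 0)"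

definition outflow_loss :: "('a set \<Rightarrow> real) \<Rightarrow> real" where
  "outflow_loss g = (outflow g vout)\<^sup>2 + (\<Sum>i\<in>N - {vout}. (outflow g i - 1)\<^sup>2)"

text \<open>The sum over index pairs \<open>k < l\<close> of an enumeration of the neighbors has symmetric
  summands, so it is written as a sum over the two-element sets of neighbors.\<close>

definition branching :: "('a set \<Rightarrow> real) \<Rightarrow> 'a \<Rightarrow> real" where
  "branching g i =
     (\<Sum>P | P \<subseteq> neighbors A i \<and> card P = 2. \<Prod>j\<in>P. max (current g i j) 0)"

definition branch_loss :: "('a set \<Rightarrow> real) \<Rightarrow> real" where
  "branch_loss g = (\<Sum>i\<in>N. branching g i)"

definition total_objective :: "real \<Rightarrow> real \<Rightarrow> ('a set \<Rightarrow> real) \<Rightarrow> real" where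
  "total_objective \<alpha>1 \<alpha>2 g = \<alpha>1 * outflow_loss g + \<alpha>2 * branch_loss g"

definition hamiltonian_configs :: "('a set \<Rightarrow> real) set" where
  "hamiltonian_configs =
     {g \<in> A0 \<rightarrow>\<^sub>E {0, 1}. \<exists>p. hamiltonian_path N A vin vout p \<and>
        path_arcs p = {a \<in> A0. g a = 1} \<union> (A - A0)}"

end

end

theory Submission
  imports Defs
begin

text \<open>The objective is nonnegative, and the configuration given by a Hamiltonian path has
  objective \<open>0\<close>: its potential drops by one along each arc of the path. Hence a global minimizer
  has objective \<open>0\<close>, so every node but \<open>vout\<close> sends out exactly one unit of current, along a single
  arc. Every node other than the terminals also receives current, so following these arcs from
  \<open>vin\<close> traverses all nodes along strictly decreasing potentials. As conductances are at most
  \<open>1\<close>, each of the \<open>card N - 1\<close> steps lowers the potential by at least \<open>1\<close>; the total drop is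
  \<open>card N - 1\<close>, so all these conductances are \<open>1\<close>, and any other conducting arc would carry a
  second outgoing current.\<close>

section \<open>Well-posedness of the potential equations\<close>

text \<open>Collects the facts common to the three augmentation cases, so that the circuit analysis
  is done only once.\<close>

locale terminal_graph = circuit N A A0 vin vout
  for N :: "'a set" and A A0 :: "'a set set" and vin vout :: 'a +
  assumes simple: "simple_graph N A"
    and subset: "A0 \<subseteq> A"
    and vin: "vin \<in> N"
    and vout: "vout \<in> N"
    and vin_neq_vout: "vin \<noteq> vout"
begin

lemma finite_nodes: "finite N"
  using simple by (simp add: simple_graph_def)

lemma arc_in_nodes: "{i, j} \<in> A \<Longrightarrow> i \<in> N" "{i, j} \<in> A \<Longrightarrow> j \<in> N" "{i, j} \<in> A \<Longrightarrow> i \<noteq> j"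
  using simple by (force simp: simple_graph_def)+

lemma arcE:
  assumes "a \<in> A"
  obtains i j where "a = {i, j}" "i \<in> N" "j \<in> N" "i \<noteq> j"
  using assms simple unfolding simple_graph_def by (metis card_2_iff insert_subset)

lemma neighbors_subset: "neighbors A i \<subseteq> N"
  by (auto simp: neighbors_def intro: arc_in_nodes)

lemma finite_neighbors: "finite (neighbors A i)"
  using neighbors_subset finite_nodes by (rule finite_subset)

lemma eff_conductance_bounds:
  assumes "g \<in> conductance_configs A0"
  shows "0 \<le> eff_conductance g a" "eff_conductance g a \<le> 1"
  using assms by (auto simp: eff_conductance_def conductance_configs_def dest: PiE_mem)

lemma sym_adjacency: "sym (adjacency B)"
  by (auto simp: sym_def adjacency_def insert_commute)

lemma component_step:
  assumes "i \<in> conducting_component g v" "{i, j} \<in> A" "eff_conductance g {i, j} > 0"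
  shows "j \<in> conducting_component g v"
proof -
  have "(i, j) \<in> adjacency (conducting_arcs g)"
    using assms by (auto simp: adjacency_def conducting_arcs_def)
  with assms(1,2) show ?thesis
    by (auto simp: conducting_component_def intro: rtrancl_into_rtrancl arc_in_nodes)
qed

lemma vin_in_component: "vin \<in> conducting_component g vin"
  using vin by (simp add: conducting_component_def)

lemma finite_component: "finite (conducting_component g v)"
  using finite_nodes by (simp add: conducting_component_def)

text \<open>Maximum principle: the difference of two potentials attains its maximum over the component
  at a terminal.\<close>

lemma is_potential_le:
  assumes g: "g \<in> conductance_configs A0"
    and \<phi>: "is_potential g \<phi>" and \<psi>: "is_potential g \<psi>"
  shows "\<phi> i \<le> \<psi> i"
proof (rule ccontr)
  assume neg: "\<not> \<phi> i \<le> \<psi> i"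
  define C where "C = conducting_component g vin"
  define d where "d = (\<lambda>i. \<phi> i - \<psi> i)"
  define M where "M = Max (d ` C)"
  have "i \<in> C"
    using neg \<phi> \<psi> unfolding is_potential_def C_def by force
  have fin: "finite C"
    by (simp add: C_def finite_component)
  have le: "d j \<le> M" if "j \<in> C" for j
    using that fin by (simp add: M_def)
  have "M > 0"
    using le[OF \<open>i \<in> C\<close>] neg by (simp add: d_def)
  obtain m where m: "m \<in> C" "d m = M"
    using Max_in[of "d ` C"] \<open>i \<in> C\<close> fin unfolding M_def by (metis empty_iff finite_imageI image_iff image_is_empty)
  have harm: "(\<Sum>j\<in>neighbors A y. eff_conductance g {y, j} * (d y - d j)) = 0"
    if "y \<in> C" "y \<noteq> vin" "y \<noteq> vout" for y
  proof -
    have "(\<Sum>j\<in>neighbors A y. eff_conductance g {y, j} * (d y - d j)) =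
        (\<Sum>j\<in>neighbors A y. eff_conductance g {y, j} * (\<phi> y - \<phi> j)) -
        (\<Sum>j\<in>neighbors A y. eff_conductance g {y, j} * (\<psi> y - \<psi> j))"
      by (simp add: sum_subtractf[symmetric] d_def algebra_simps)
    then show ?thesis
      using \<phi> \<psi> that by (simp add: is_potential_def C_def)
  qed
  have terminal: "d vin = 0" "d vout = 0"
    using \<phi> \<psi> by (simp_all add: is_potential_def d_def)
  \<comment> \<open>The set where \<open>d\<close> attains \<open>M\<close> spreads along conducting
    arcs until it reaches \<open>vin\<close>, where \<open>d\<close> is 0.\<close>
  have "x \<in> C \<and> d x = M" if "(m, x) \<in> (adjacency (conducting_arcs g))\<^sup>*" for x
    using that
  proof (induction rule: rtrancl_induct)
    case base
    then show ?case using m by simp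
  next
    case (step y z)
    have arc: "{y, z} \<in> A" "eff_conductance g {y, z} > 0"
      using step by (auto simp: adjacency_def conducting_arcs_def)
    have zC: "z \<in> C"
      using component_step arc step unfolding C_def by blast
    have "y \<noteq> vin" "y \<noteq> vout"
      using step \<open>M > 0\<close> terminal by auto
    then have 0: "(\<Sum>j\<in>neighbors A y. eff_conductance g {y, j} * (d y - d j)) = 0"
      using step harm by blast
    \<comment> \<open>A nonconducting arc contributes 0, and a conducting one leads to a node of
      \<open>C\<close>, where \<open>d\<close> is at most \<open>M = d y\<close>.\<close>
    have nonneg: "0 \<le> eff_conductance g {y, j} * (d y - d j)" if "j \<in> neighbors A y" for j
    proof (cases "eff_conductance g {y, j} > 0")
      case True
      then have "j \<in> C"
        using component_step that step unfolding C_def neighbors_def by blast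
      then show ?thesis
        using le step True by simp
    next
      case False
      then show ?thesis
        using eff_conductance_bounds(1)[OF g, of "{y, j}"] by simp
    qed
    have "eff_conductance g {y, z} * (d y - d z) = 0"
      using 0 nonneg arc(1) finite_neighbors
      by (subst (asm) sum_nonneg_eq_0_iff) (auto simp: neighbors_def)
    then show ?case
      using arc(2) step zC by simp
  qed
  moreover have "(m, vin) \<in> (adjacency (conducting_arcs g))\<^sup>*"
    using m(1) unfolding C_def conducting_component_def
    by (metis (no_types, lifting) mem_Collect_eq symD sym_rtrancl sym_adjacency)
  ultimately show False
    using terminal \<open>M > 0\<close> by auto
qed

lemma is_potential_unique:
  assumes "g \<in> conductance_configs A0" "is_potential g \<phi>" "is_potential g \<psi>"
  shows "\<phi> = \<psi>"
  by (intro ext antisym is_potential_le[OF assms(1)] assms)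

text \<open>Repeatedly replacing the value at each interior node by the weighted mean over its neighbors,
  starting from the smallest admissible values, gives increasing bounded sequences whose limits
  solve the equations.\<close>

lemma is_potential_exists:
  assumes g: "g \<in> conductance_configs A0"
  shows "\<exists>\<phi>. is_potential g \<phi>"
proof -
  define I where "I = conducting_component g vin - {vin, vout}"
  define c where "c = (\<lambda>i j. eff_conductance g {i, j})"
  define W where "W = (\<lambda>i. \<Sum>j\<in>neighbors A i. c i j)"
  define K where "K = real (card N) - 1"
  define f0 where "f0 = (\<lambda>i. if i = vin then K else 0)"
  \<comment> \<open>Since \<open>inverse 0 = 0\<close>, a node with \<open>W i = 0\<close> gets mean
    0, and the bounds below hold there as well.\<close>
  define av where "av = (\<lambda>f i. if i \<in> I then (\<Sum>j\<in>neighbors A i. c i j * f j) * inverse (W i) else f i)"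
  define F where "F = (\<lambda>k. (av ^^ k) f0)"
  have F_Suc: "F (Suc k) = av (F k)" for k
    by (simp add: F_def)
  have c0: "0 \<le> c i j" for i j
    using eff_conductance_bounds[OF g] by (simp add: c_def)
  have W0: "0 \<le> W i" for i
    by (simp add: W_def c0 sum_nonneg)
  have "card N > 0"
    using finite_nodes vin by (auto simp: card_gt_0_iff)
  then have K0: "0 \<le> K"
    by (simp add: K_def)
  have av_mono: "av f i \<le> av f' i" if "\<And>j. f j \<le> f' j" for f f' i
    using that by (auto simp: av_def c0 W0 intro!: sum_mono mult_mono mult_right_mono mult_left_mono)
  have ub: "F k i \<le> K" for k i
  proof (induction k arbitrary: i)
    case 0
    then show ?case using K0 by (simp add: F_def f0_def)
  next
    case (Suc k)
    have "(\<Sum>j\<in>neighbors A i. c i j * F k j) \<le> (\<Sum>j\<in>neighbors A i. c i j * K)"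
      by (intro sum_mono mult_left_mono Suc c0)
    also have "\<dots> = W i * K"
      by (simp add: W_def sum_distrib_right)
    finally have "(\<Sum>j\<in>neighbors A i. c i j * F k j) * inverse (W i) \<le> W i * K * inverse (W i)"
      by (intro mult_right_mono) (simp_all add: W0)
    also have "\<dots> \<le> K"
      using K0 by (cases "W i = 0") (simp_all add: field_simps)
    finally show ?case
      using Suc by (simp add: F_Suc av_def)
  qed
  have inc: "F k i \<le> F (Suc k) i" for k i
  proof (induction k arbitrary: i)
    \<comment> \<open>\<open>f0\<close> vanishes on \<open>I\<close>, because \<open>vin\<close> is
      not in \<open>I\<close>, so the first averaging can only raise values.\<close>
    case 0
    have "0 \<le> av f0 i"
      using K0 c0 W0 by (auto simp: av_def f0_def intro!: sum_nonneg mult_nonneg_nonneg)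
    then show ?case
      by (auto simp: F_def f0_def av_def I_def)
  next
    case (Suc k)
    then show ?case
      unfolding F_Suc[of k] F_Suc[of "Suc k"] by (intro av_mono) simp
  qed
  have "\<exists>L. (\<lambda>k. F k i) \<longlonglongrightarrow> L" for i
  proof -
    have "incseq (\<lambda>k. F k i)"
      using inc by (rule incseq_SucI)
    then show ?thesis
      using ub incseq_convergent[of "\<lambda>k. F k i" K] by blast
  qed
  then obtain \<phi> where lim: "\<And>i. (\<lambda>k. F k i) \<longlonglongrightarrow> \<phi> i"
    by metis
  have fix_outside: "\<phi> i = f0 i" if "i \<notin> I" for i
  proof -
    have "F k i = f0 i" for k
      using that by (induction k) (simp_all add: F_Suc av_def, simp add: F_def)
    then show ?thesis
      using lim[of i] LIMSEQ_unique by (simp add: LIMSEQ_const_iff)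
  qed
  have "(\<Sum>j\<in>neighbors A i. c i j * (\<phi> i - \<phi> j)) = 0" if "i \<in> I" for i
  proof -
    \<comment> \<open>The shifted sequence converges to the mean of the limits and also to
      \<open>\<phi> i\<close>, so \<open>\<phi>\<close> is a fixed point of
      \<open>av\<close>.\<close>
    have "(\<lambda>k. F (Suc k) i) \<longlonglongrightarrow> (\<Sum>j\<in>neighbors A i. c i j * \<phi> j) * inverse (W i)"
      using that by (auto simp: F_Suc av_def intro!: tendsto_intros lim)
    then have eq: "\<phi> i = (\<Sum>j\<in>neighbors A i. c i j * \<phi> j) * inverse (W i)"
      using LIMSEQ_Suc[OF lim[of i]] LIMSEQ_unique by blast
    show ?thesis
    proof (cases "W i = 0")
      case True
      then have "\<forall>j\<in>neighbors A i. c i j = 0"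
        unfolding W_def by (subst (asm) sum_nonneg_eq_0_iff) (auto simp: finite_neighbors c0)
      then show ?thesis by simp
    next
      case False
      then have "W i * \<phi> i = (\<Sum>j\<in>neighbors A i. c i j * \<phi> j)"
        by (subst eq) simp
      then show ?thesis
        by (simp add: W_def right_diff_distrib sum_subtractf sum_distrib_right)
    qed
  qed
  moreover have "\<phi> vin = K" "\<phi> vout = 0"
    using fix_outside vin_neq_vout by (auto simp: I_def f0_def)
  moreover have "\<phi> i = 0" if "i \<notin> conducting_component g vin" for i
    using fix_outside[of i] that vin_in_component by (auto simp: I_def f0_def)
  ultimately have "is_potential g \<phi>"
    by (auto simp: is_potential_def I_def K_def c_def)
  then show ?thesis by blast
qed

text \<open>Existence and uniqueness make the definite description in \<open>potential\<close>
  meaningful; from here on the potential is known through its equations.\<close>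

lemma is_potential_potential:
  assumes "g \<in> conductance_configs A0" "vout \<in> conducting_component g vin"
  shows "is_potential g (potential g)"
proof -
  have "\<exists>!\<phi>. is_potential g \<phi>"
    using is_potential_exists is_potential_unique assms(1) by blast
  then show ?thesis
    using assms(2) by (simp add: potential_def theI')
qed

text \<open>Lets a potential be computed by exhibiting a solution, as is done for the configuration
  of a Hamiltonian path.\<close>

lemma potential_eqI:
  assumes "g \<in> conductance_configs A0" "vout \<in> conducting_component g vin" "is_potential g \<phi>"
  shows "potential g = \<phi>"
  using is_potential_unique[OF assms(1)] is_potential_potential assms by blast

lemma current_swap: "current g j i = - current g i j"
  by (simp add: current_def insert_commute algebra_simps)

section \<open>Configurations with vanishing objective\<close>

lemma finite_neighbor_pairs: "finite {P. P \<subseteq> neighbors A i \<and> card P = 2}"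
  by (rule finite_subset[of _ "Pow (neighbors A i)"]) (auto simp: finite_neighbors)

lemma branching_nonneg: "0 \<le> branching g i"
  unfolding branching_def by (intro sum_nonneg prod_nonneg) simp

lemma branch_loss_nonneg: "0 \<le> branch_loss g"
  unfolding branch_loss_def by (intro sum_nonneg branching_nonneg)

lemma outflow_loss_nonneg: "0 \<le> outflow_loss g"
  unfolding outflow_loss_def by (intro add_nonneg_nonneg sum_nonneg) simp_all

lemma outflow_loss_eq_0:
  assumes "outflow_loss g = 0"
  shows "outflow g vout = 0" "i \<in> N - {vout} \<Longrightarrow> outflow g i = 1"
proof -
  have nonneg: "0 \<le> (\<Sum>i\<in>N - {vout}. (outflow g i - 1)\<^sup>2)"
    by (intro sum_nonneg) simp
  have "(outflow g vout)\<^sup>2 = 0 \<and> (\<Sum>i\<in>N - {vout}. (outflow g i - 1)\<^sup>2) = 0"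
    using assms nonneg unfolding outflow_loss_def by (subst (asm) add_nonneg_eq_0_iff) simp_all
  then show "outflow g vout = 0" "i \<in> N - {vout} \<Longrightarrow> outflow g i = 1"
    by (simp_all add: sum_nonneg_eq_0_iff finite_nodes)
qed

text \<open>The branching term is a sum of nonnegative products, so each of them vanishes, in
  particular the one for the pair \<open>{j, k}\<close>.\<close>

lemma branching_eq_0:
  assumes "branching g i = 0" "j \<in> neighbors A i" "k \<in> neighbors A i" "j \<noteq> k"
    "current g i j > 0"
  shows "current g i k \<le> 0"
proof -
  have "\<forall>P\<in>{P. P \<subseteq> neighbors A i \<and> card P = 2}. (\<Prod>j\<in>P. max (current g i j) 0) = 0"
    using assms(1) unfolding branching_def
    by (subst (asm) sum_nonneg_eq_0_iff) (auto simp: finite_neighbor_pairs intro: prod_nonneg)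
  then have "(\<Prod>j\<in>{j, k}. max (current g i j) 0) = 0"
    using assms(2-4) by (intro bspec[where x = "{j, k}"]) auto
  then show ?thesis
    using assms(4,5) by (auto simp: max_def split: if_splits)
qed

text \<open>A nonzero outflow has a positive summand, and vanishing branching allows only one, which
  therefore carries the whole unit.\<close>

lemma unique_out_arc:
  assumes "branching g i = 0" "outflow g i = 1"
  obtains j where "{i, j} \<in> A" "current g i j = 1"
    "\<And>k. {i, k} \<in> A \<Longrightarrow> k \<noteq> j \<Longrightarrow> current g i k \<le> 0"
proof -
  obtain j where j: "j \<in> neighbors A i" "max (current g i j) 0 \<noteq> 0"
    using assms(2) sum.neutral[of "neighbors A i" "\<lambda>j. max (current g i j) 0"]
    unfolding outflow_def by fastforce
  then have pos: "current g i j > 0"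
    by (simp add: max_def split: if_splits)
  have other: "current g i k \<le> 0" if "{i, k} \<in> A" "k \<noteq> j" for k
    using branching_eq_0[OF assms(1) j(1) _ _ pos, of k] that by (simp add: neighbors_def)
  have "outflow g i = (\<Sum>k\<in>{j}. max (current g i k) 0)"
    unfolding outflow_def using j(1) other
    by (intro sum.mono_neutral_right finite_neighbors) (auto simp: neighbors_def)
  with assms(2) pos have "current g i j = 1"
    by simp
  with j(1) other show ?thesis
    by (intro that) (simp_all add: neighbors_def)
qed

text \<open>Works from the termwise consequences of a vanishing objective, which are equations free
  of the weights \<alpha>1 and \<alpha>2.\<close>

lemma vanishing_objective_hamiltonian:
  assumes g: "g \<in> conductance_configs A0"
    and out_vout: "outflow g vout = 0"
    and out: "\<And>i. i \<in> N - {vout} \<Longrightarrow> outflow g i = 1"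
    and branch: "\<And>i. i \<in> N \<Longrightarrow> branching g i = 0"
  shows "g \<in> hamiltonian_configs"
proof -

  \<comment> \<open>Successors along unit currents\<close>
  have "\<exists>j. {i, j} \<in> A \<and> current g i j = 1 \<and>
      (\<forall>k. {i, k} \<in> A \<longrightarrow> k \<noteq> j \<longrightarrow> current g i k \<le> 0)" if "i \<in> N - {vout}" for i
    using unique_out_arc[of g i] branch[of i] out[OF that] that by (metis DiffD1)
  then obtain s where s: "\<And>i. i \<in> N - {vout} \<Longrightarrow> {i, s i} \<in> A"
      "\<And>i. i \<in> N - {vout} \<Longrightarrow> current g i (s i) = 1"
      "\<And>i k. i \<in> N - {vout} \<Longrightarrow> {i, k} \<in> A \<Longrightarrow> k \<noteq> s i \<Longrightarrow> current g i k \<le> 0"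
    by metis
  define \<phi> where "\<phi> = potential g"
  have cur: "current g i j = eff_conductance g {i, j} * (\<phi> i - \<phi> j)" for i j
    by (simp add: current_def \<phi>_def)
  \<comment> \<open>With the terminals disconnected the potential is 0 everywhere by convention, so
    no current could leave \<open>vin\<close>.\<close>
  have reach: "vout \<in> conducting_component g vin"
  proof (rule ccontr)
    assume "vout \<notin> conducting_component g vin"
    then have "current g vin (s vin) = 0"
      by (simp add: current_def potential_def)
    then show False
      using s(2)[of vin] vin vin_neq_vout by simp
  qed
  then have pot: "is_potential g \<phi>"
    using is_potential_potential g \<phi>_def by blast
  note bounds = eff_conductance_bounds[OF g]
  \<comment> \<open>A node off the component has potential 0. Its unit current needs a conducting
    arc to \<open>s i\<close>, so \<open>s i\<close> is off the component too and has potential 0,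
    which excludes any current.\<close>
  have all: "i \<in> conducting_component g vin" if "i \<in> N" for i
  proof (rule ccontr)
    assume i: "i \<notin> conducting_component g vin"
    then have "i \<in> N - {vout}"
      using that reach by auto
    note si = s(1,2)[OF this]
    then have "eff_conductance g {i, s i} > 0"
      using bounds(1)[of "{i, s i}"] cur[of i "s i"] by (cases "eff_conductance g {i, s i} = 0") auto
    then have "s i \<notin> conducting_component g vin"
      using component_step[of "s i" g vin i] si i by (auto simp: insert_commute)
    then show False
      using i si(2) pot by (simp add: cur is_potential_def)
  qed
  \<comment> \<open>A unit current through a conductance of at most 1 costs a potential drop of at
    least 1.\<close>
  have drop: "\<phi> (s i) \<le> \<phi> i - 1" if "i \<in> N - {vout}" for i
  proof -
    have 1: "eff_conductance g {i, s i} * (\<phi> i - \<phi> (s i)) = 1"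
      using s(2)[OF that] cur by simp
    then have "0 < \<phi> i - \<phi> (s i)"
      using bounds(1)[of "{i, s i}"] by (metis zero_less_mult_pos zero_less_one less_le mult_zero_left)
    then have "eff_conductance g {i, s i} * (\<phi> i - \<phi> (s i)) \<le> 1 * (\<phi> i - \<phi> (s i))"
      by (intro mult_right_mono bounds) simp
    with 1 show ?thesis by simp
  qed
  \<comment> \<open>By Kirchhoff's law the unit leaving \<open>i\<close> is balanced by current
    entering from some \<open>j\<close>. Since \<open>vout\<close> emits nothing, \<open>j\<close>
    has a successor, and its only positive current goes there.\<close>
  have pred: "\<exists>j\<in>N - {vout}. s j = i" if i: "i \<in> N - {vin, vout}" for i
  proof -
    have sum0: "(\<Sum>j\<in>neighbors A i. current g i j) = 0"
      using pot i all by (simp add: is_potential_def cur)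
    have "\<exists>j\<in>neighbors A i. current g i j < 0"
    proof (rule ccontr)
      assume "\<not> ?thesis"
      then have "\<forall>j\<in>neighbors A i. current g i j = 0"
        using sum0 by (subst (asm) sum_nonneg_eq_0_iff) (auto simp: finite_neighbors not_less)
      then show False
        using s(1,2)[of i] i by (auto simp: neighbors_def)
    qed
    then obtain j where j: "{i, j} \<in> A" "current g i j < 0"
      by (auto simp: neighbors_def)
    then have pos: "current g j i > 0"
      by (simp add: current_swap[of g j i])
    have ji: "{j, i} \<in> A"
      using j(1) by (simp add: insert_commute)
    have "j \<noteq> vout"
    proof
      assume "j = vout"
      have "\<forall>k\<in>neighbors A vout. max (current g vout k) 0 = 0"
        using out_vout unfolding outflow_def
        by (subst (asm) sum_nonneg_eq_0_iff) (auto simp: finite_neighbors)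
      then have "max (current g vout i) 0 = 0"
        using ji \<open>j = vout\<close> by (simp add: neighbors_def)
      then show False
        using pos \<open>j = vout\<close> by simp
    qed
    then have "j \<in> N - {vout}"
      using arc_in_nodes(2)[OF j(1)] by simp
    moreover from this have "s j = i"
      using s(3)[of j i] ji pos by force
    ultimately show ?thesis by blast
  qed

  \<comment> \<open>The trajectory from \<open>vin\<close>\<close>
  define x where "x = (\<lambda>k. (s ^^ k) vin)"
  have x_Suc: "x (Suc k) = s (x k)" for k
    by (simp add: x_def)
  have x0: "x 0 = vin"
    by (simp add: x_def)
  \<comment> \<open>Otherwise every step lowers the potential, which makes the trajectory injective
    into the finite set \<open>N\<close>.\<close>
  have "\<exists>k. x k = vout"
  proof (rule ccontr)
    assume neg: "\<not> (\<exists>k. x k = vout)"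
    have mem: "x k \<in> N - {vout}" for k
    proof (induction k)
      case 0
      then show ?case using vin vin_neq_vout by (simp add: x0)
    next
      case (Suc k)
      then show ?case using neg s(1) arc_in_nodes(2) unfolding x_Suc by (metis DiffI singletonD x_Suc)
    qed
    have "\<phi> (x (Suc k)) < \<phi> (x k)" for k
      using drop[OF mem[of k]] by (simp add: x_Suc)
    then have "\<phi> (x l) < \<phi> (x k)" if "k < l" for k l
      using that by (rule lift_Suc_mono_less[of "\<lambda>k. - \<phi> (x k)", simplified])
    then have "inj x"
      by (intro injI) (metis less_irrefl linorder_neqE_nat)
    then have "infinite (range x)"
      by (simp add: finite_image_iff)
    moreover have "finite (range x)"
      using mem by (intro finite_subset[OF _ finite_nodes]) auto
    ultimately show False by simp
  qed
  \<comment> \<open>The first hit is taken because \<open>s\<close> is unspecified at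
    \<open>vout\<close>: all earlier nodes lie in \<open>N - {vout}\<close>.\<close>
  define n where "n = (LEAST k. x k = vout)"
  have xn: "x n = vout"
    using \<open>\<exists>k. x k = vout\<close> unfolding n_def by (rule LeastI_ex)
  have xk_neq: "x k \<noteq> vout" if "k < n" for k
    using that not_less_Least unfolding n_def by blast
  have "n > 0"
    using xn x0 vin_neq_vout by (cases n) auto
  have x_mem: "k \<le> n \<Longrightarrow> x k \<in> N" for k
  proof (induction k)
    case 0
    then show ?case using vin by (simp add: x0)
  next
    case (Suc k)
    then show ?case using s(1)[of "x k"] xk_neq[of k] arc_in_nodes(2) by (simp add: x_Suc)
  qed
  have x_mem': "x k \<in> N - {vout}" if "k < n" for k
    using that x_mem xk_neq by simp
  have x_drop: "\<phi> (x (Suc k)) \<le> \<phi> (x k) - 1" if "k < n" for k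
    using drop[OF x_mem'[OF that]] by (simp add: x_Suc)
  have x_drop_add: "k + m \<le> n \<Longrightarrow> \<phi> (x (k + m)) \<le> \<phi> (x k) - real m" for k m
  proof (induction m)
    case (Suc m)
    then show ?case using x_drop[of "k + m"] by simp
  qed simp
  have x_less: "\<phi> (x l) < \<phi> (x k)" if "k < l" "l \<le> n" for k l
    using x_drop_add[of k "l - k"] that by simp
  have x_inj: "inj_on x {..n}"
  proof (rule inj_onI)
    fix k l assume "k \<in> {..n}" "l \<in> {..n}" "x k = x l"
    then show "k = l"
      using x_less[of k l] x_less[of l k] by (cases k l rule: linorder_cases) auto
  qed
  \<comment> \<open>An unvisited node of largest potential has a predecessor of larger potential,
    which must then be visited. That predecessor is not \<open>vout\<close>, so the trajectory
    continues from it to the supposedly unvisited node.\<close>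
  have cover: "N \<subseteq> x ` {..n}"
  proof (rule ccontr)
    assume "\<not> N \<subseteq> x ` {..n}"
    define U where "U = N - x ` {..n}"
    have U: "finite U" "U \<noteq> {}"
      using finite_nodes \<open>\<not> N \<subseteq> x ` {..n}\<close> by (auto simp: U_def)
    then have "Max (\<phi> ` U) \<in> \<phi> ` U"
      by (intro Max_in) auto
    then obtain i where i: "i \<in> U" "\<phi> i = Max (\<phi> ` U)"
      by auto
    have "i \<in> N - {vin, vout}"
      using i(1) x0 xn by (auto simp: U_def image_iff)
    then obtain j where j: "j \<in> N - {vout}" "s j = i"
      using pred by blast
    have "\<phi> i < \<phi> j"
      using drop[OF j(1)] j(2) by simp
    then have "j \<notin> U"
      using i(2) U(1) Max_ge[of "\<phi> ` U" "\<phi> j"] by (metis finite_imageI imageI not_less)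
    then obtain k where k: "k \<le> n" "j = x k"
      using j(1) by (auto simp: U_def)
    then have "k < n"
      using j(1) xn by (cases "k = n") auto
    then have "i \<in> x ` {..n}"
      using j(2) k x_Suc[of k] by (intro image_eqI[of _ _ "Suc k"]) auto
    then show False
      using i(1) by (simp add: U_def)
  qed

  \<comment> \<open>Exact potentials and conductances\<close>
  then have N_eq: "N = x ` {..n}"
    using x_mem by auto
  \<comment> \<open>The prescribed total drop \<open>card N - 1\<close> thus equals the number
    \<open>n\<close> of steps, which leaves no slack in the individual drops.\<close>
  then have "card N = Suc n"
    by (simp add: card_image x_inj)
  then have \<phi>0: "\<phi> (x 0) = real n"
    using pot by (simp add: is_potential_def x0)
  \<comment> \<open>Counting the drops forward from \<open>vin\<close> gives the upper bound, and
    counting those that remain before \<open>vout\<close> gives the lower one.\<close>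
  have \<phi>_x: "\<phi> (x k) = real n - real k" if "k \<le> n" for k
  proof (rule antisym)
    show "\<phi> (x k) \<le> real n - real k"
      using x_drop_add[of 0 k] that \<phi>0 by simp
    have "\<phi> (x n) = 0"
      using pot by (simp add: is_potential_def xn)
    then show "real n - real k \<le> \<phi> (x k)"
      using x_drop_add[of k "n - k"] that by (simp add: of_nat_diff)
  qed
  have eff_path: "eff_conductance g {x k, x (Suc k)} = 1" if "k < n" for k
    using s(2)[OF x_mem'[OF that]] that by (simp add: cur x_Suc[symmetric] \<phi>_x)
  \<comment> \<open>A chord spans the positive potential difference \<open>l - k\<close>; if it
    conducted, it would carry a second outgoing current at \<open>x k\<close>.\<close>
  have eff_other: "eff_conductance g {x k, x l} = 0"
    if "Suc k < l" "l \<le> n" "{x k, x l} \<in> A" for k l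
  proof -
    have "x l \<noteq> s (x k)"
      using inj_onD[OF x_inj, of l "Suc k"] that by (auto simp: x_Suc)
    then have "current g (x k) (x l) \<le> 0"
      using s(3)[OF x_mem'[of k]] that by simp
    then have "eff_conductance g {x k, x l} * (real l - real k) \<le> 0"
      using that by (simp add: cur \<phi>_x)
    then show ?thesis
      using that bounds(1)[of "{x k, x l}"] by (simp add: mult_le_0_iff)
  qed
  have eff: "a \<in> {{x k, x (Suc k)} | k. k < n} \<and> eff_conductance g a = 1 \<or>
      a \<notin> {{x k, x (Suc k)} | k. k < n} \<and> eff_conductance g a = 0" if a: "a \<in> A" for a
  proof -
    obtain i j where ij: "a = {i, j}" "i \<in> N" "j \<in> N" "i \<noteq> j"
      using a by (rule arcE)
    then obtain k l where kl: "k < l" "l \<le> n" "a = {x k, x l}"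
    proof -
      obtain k l where "k \<le> n" "l \<le> n" "i = x k" "j = x l"
        using ij N_eq by auto
      then show ?thesis
        using ij that[of k l] that[of l k] by (cases k l rule: linorder_cases) (auto simp: insert_commute)
    qed
    show ?thesis
    proof (cases "l = Suc k")
      case True
      then show ?thesis using kl eff_path by auto
    next
      case False
      then have "eff_conductance g a = 0"
        using kl eff_other a by simp
      \<comment> \<open>Path arcs have conductance 1, so conductance 0 also shows that
        \<open>a\<close> is not one of them.\<close>
      then show ?thesis
        using eff_path by auto
    qed
  qed

  \<comment> \<open>The trajectory as a Hamiltonian path\<close>
  define p where "p = map x [0..<Suc n]"
  have len: "length p = Suc n"
    by (simp add: p_def)
  have nth: "p ! k = x k" if "k \<le> n" for k
    using that by (simp add: p_def del: upt_Suc)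
  have path_arcs: "path_arcs p = {{x k, x (Suc k)} | k. k < n}"
    unfolding path_arcs_def by (intro Collect_cong arg_cong[where f = Ex] ext) (auto simp: len nth)
  have sub: "path_arcs p \<subseteq> A"
    using s(1)[OF x_mem'] by (auto simp: path_arcs x_Suc)
  have "hamiltonian_path N A vin vout p"
    unfolding hamiltonian_path_def
  proof (intro conjI)
    show "p \<noteq> []" "hd p = vin" "last p = vout"
      by (simp_all add: p_def hd_map last_map x0 xn del: upt_Suc)
    show "distinct p"
      using x_inj by (simp add: p_def distinct_map atLeast0LessThan lessThan_Suc_atMost del: upt_Suc)
    show "set p = N"
      by (simp add: p_def N_eq atLeast0LessThan lessThan_Suc_atMost del: upt_Suc)
    show "successively (\<lambda>i j. {i, j} \<in> A) p"
      using s(1)[OF x_mem'] by (simp add: successively_conv_nth p_def x_Suc[symmetric] del: upt_Suc)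
  qed
  \<comment> \<open>An arc of \<open>A - A0\<close> has effective conductance 1 by definition, hence
    lies on the path by \<open>eff\<close>.\<close>
  moreover have "path_arcs p = {a \<in> A0. g a = 1} \<union> (A - A0)"
  proof (rule set_eqI)
    fix a
    show "a \<in> path_arcs p \<longleftrightarrow> a \<in> {a \<in> A0. g a = 1} \<union> (A - A0)"
      using eff[of a] sub subset unfolding path_arcs[symmetric]
      by (cases "a \<in> A") (auto simp: eff_conductance_def split: if_splits)
  qed
  moreover have "g \<in> A0 \<rightarrow>\<^sub>E {0, 1}"
  proof (rule PiE_I)
    show "g a \<in> {0, 1}" if "a \<in> A0" for a
      using eff[of a] subset that by (auto simp: eff_conductance_def)
    show "g a = undefined" if "a \<notin> A0" for a
      using g that by (auto simp: conductance_configs_def)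
  qed
  ultimately show ?thesis
    unfolding hamiltonian_configs_def by blast
qed

text \<open>Switching on exactly the path arcs sends a unit current along the path. Arcs outside
  \<open>A0\<close> always conduct, so \<open>new\<close> requires the path to contain them.\<close>

lemma hamiltonian_path_objective_0:
  assumes p: "hamiltonian_path N A vin vout p" and new: "A - A0 \<subseteq> path_arcs p"
  shows "\<exists>g\<in>conductance_configs A0. total_objective \<alpha>1 \<alpha>2 g = 0"
proof -
  define n where "n = length p - 1"
  define x where "x = nth p"
  define g where "g = (\<lambda>a\<in>A0. if a \<in> path_arcs p then 1 else 0 :: real)"
  have len: "length p = Suc n"
    using p by (simp add: hamiltonian_path_def n_def)
  have x0: "x 0 = vin" and xn: "x n = vout"
    using p by (auto simp: hamiltonian_path_def x_def n_def hd_conv_nth last_conv_nth)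
  have inj: "x k = x l \<longleftrightarrow> k = l" if "k \<le> n" "l \<le> n" for k l
    using p that by (simp add: hamiltonian_path_def x_def nth_eq_iff_index_eq len)
  have N_eq: "N = x ` {..n}"
    using p by (auto simp: hamiltonian_path_def x_def set_conv_nth len less_Suc_eq_le)
  have card: "card N = Suc n"
    using p by (metis hamiltonian_path_def distinct_card len)
  have arcs: "{x k, x (Suc k)} \<in> A" if "k < n" for k
    using p that by (simp add: hamiltonian_path_def x_def successively_conv_nth len)
  have in_path: "{x k, x l} \<in> path_arcs p \<longleftrightarrow> l = Suc k \<or> k = Suc l" if "k \<le> n" "l \<le> n" for k l
  proof
    assume "{x k, x l} \<in> path_arcs p"
    then obtain m where "Suc m \<le> n" "{x k, x l} = {x m, x (Suc m)}"
      by (force simp: path_arcs_def x_def len)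
    then show "l = Suc k \<or> k = Suc l"
      using that by (auto simp: doubleton_eq_iff inj)
  next
    assume "l = Suc k \<or> k = Suc l"
    then show "{x k, x l} \<in> path_arcs p"
      using that by (auto simp: path_arcs_def x_def len insert_commute)
  qed
  have gc: "g \<in> conductance_configs A0"
    by (auto simp: g_def conductance_configs_def)
  have eff: "eff_conductance g a = (if a \<in> path_arcs p then 1 else 0)" if "a \<in> A" for a
    using that new by (auto simp: eff_conductance_def g_def)
  have comp: "k \<le> n \<Longrightarrow> x k \<in> conducting_component g vin" for k
  proof (induction k)
    case 0
    then show ?case by (simp add: x0 vin_in_component)
  next
    case (Suc k)
    then have arc: "{x k, x (Suc k)} \<in> A" and "x k \<in> conducting_component g vin"
      using arcs by simp_all
    moreover have "eff_conductance g {x k, x (Suc k)} > 0"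
      using Suc.prems by (simp add: eff[OF arc] in_path)
    ultimately show ?case
      using component_step by blast
  qed
  \<comment> \<open>The potential counts the arcs left on the path to \<open>vout\<close>; the value
    0 off \<open>N\<close> matches the normalisation in \<open>is_potential\<close>.\<close>
  define \<phi> where "\<phi> = (\<lambda>i. if i \<in> N then real n - real (the_inv_into {..n} x i) else 0)"
  have "inj_on x {..n}"
    by (rule inj_onI) (simp add: inj)
  then have \<phi>_x: "\<phi> (x k) = real n - real k" if "k \<le> n" for k
    using that by (simp add: \<phi>_def N_eq the_inv_into_f_f)
  have flow: "eff_conductance g {x k, x l} * (\<phi> (x k) - \<phi> (x l)) =
      (if l = Suc k then 1 else if k = Suc l then -1 else 0)"
    if "{x k, x l} \<in> A" "k \<le> n" "l \<le> n" for k l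
    using that by (simp add: eff in_path \<phi>_x)
  have nbr: "\<exists>l\<le>n. j = x l" if "j \<in> neighbors A i" for i j
    using neighbors_subset that N_eq by blast
  have "is_potential g \<phi>"
    unfolding is_potential_def
  proof (intro conjI ballI allI impI)
    show "\<phi> vin = real (card N) - 1"
      using \<phi>_x[of 0] by (simp add: x0 card)
    show "\<phi> vout = 0"
      using \<phi>_x[of n] by (simp add: xn)
    show "\<phi> i = 0" if "i \<notin> conducting_component g vin" for i
      using that comp by (auto simp: \<phi>_def N_eq)
    fix i assume i: "i \<in> conducting_component g vin - {vin, vout}"
    then have "i \<in> N"
      by (simp add: conducting_component_def)
    then obtain m where m: "m \<le> n" "i = x m"
      by (auto simp: N_eq)
    moreover have "m \<noteq> 0" "m \<noteq> n"
      using i m x0 xn by (auto intro: ccontr)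
    ultimately obtain k where k: "m = Suc k" "Suc (Suc k) \<le> n" "i = x (Suc k)"
      by (cases m) auto
    \<comment> \<open>Only the predecessor and the successor on the path contribute to the sum at an
      interior node, with currents -1 and 1 that cancel.\<close>
    have nb: "{x k, x (Suc (Suc k))} \<subseteq> neighbors A i"
      using arcs[of k] arcs[of "Suc k"] k by (auto simp: neighbors_def insert_commute)
    have "(\<Sum>j\<in>neighbors A i. eff_conductance g {i, j} * (\<phi> i - \<phi> j)) =
        (\<Sum>j\<in>{x k, x (Suc (Suc k))}. eff_conductance g {i, j} * (\<phi> i - \<phi> j))"
    proof (intro sum.mono_neutral_right finite_neighbors nb ballI)
      fix j assume j: "j \<in> neighbors A i - {x k, x (Suc (Suc k))}"
      then obtain l where l: "l \<le> n" "j = x l"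
        using nbr by blast
      then have "l \<noteq> k" "l \<noteq> Suc (Suc k)"
        using j by auto
      then show "eff_conductance g {i, j} * (\<phi> i - \<phi> j) = 0"
        using flow[of "Suc k" l] j l k by (auto simp: neighbors_def)
    qed
    also have "\<dots> = 0"
      using flow[of "Suc k" k] flow[of "Suc k" "Suc (Suc k)"] nb k by (auto simp: inj neighbors_def)
    finally show "(\<Sum>j\<in>neighbors A i. eff_conductance g {i, j} * (\<phi> i - \<phi> j)) = 0" .
  qed
  then have pot: "potential g = \<phi>"
    using comp[of n] by (intro potential_eqI gc) (simp_all add: xn)
  have pos: "max (current g (x k) (x l)) 0 = (if l = Suc k then 1 else 0)"
    if "{x k, x l} \<in> A" "k \<le> n" "l \<le> n" for k l
    using flow[OF that] by (simp add: current_def pot)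
  have "outflow g (x k) = 1" if "k < n" for k
  proof -
    have "outflow g (x k) = (\<Sum>j\<in>{x (Suc k)}. max (current g (x k) j) 0)"
      unfolding outflow_def
    proof (intro sum.mono_neutral_right finite_neighbors ballI)
      show "{x (Suc k)} \<subseteq> neighbors A (x k)"
        using arcs that by (simp add: neighbors_def)
      fix j assume j: "j \<in> neighbors A (x k) - {x (Suc k)}"
      then obtain l where "l \<le> n" "j = x l"
        using nbr by blast
      then show "max (current g (x k) j) 0 = 0"
        using pos[of k l] j that by (auto simp: neighbors_def)
    qed
    then show ?thesis
      using pos[of k "Suc k"] arcs[of k] that by simp
  qed
  then have "outflow g i = 1" if "i \<in> N - {vout}" for i
    using that xn by (auto simp: N_eq) (metis le_neq_implies_less)
  moreover have "outflow g vout = 0"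
    unfolding outflow_def
  proof (intro sum.neutral ballI)
    fix j assume j: "j \<in> neighbors A vout"
    then obtain l where "l \<le> n" "j = x l"
      using nbr by blast
    then show "max (current g vout j) 0 = 0"
      using pos[of n l] j by (auto simp: neighbors_def xn)
  qed
  ultimately have "outflow_loss g = 0"
    by (simp add: outflow_loss_def)
  moreover have "branch_loss g = 0"
    unfolding branch_loss_def branching_def
  proof (intro sum.neutral ballI)
    fix i P assume "i \<in> N" and "P \<in> {P. P \<subseteq> neighbors A i \<and> card P = 2}"
    then obtain a b where ab: "P = {a, b}" "a \<noteq> b" "{i, a} \<in> A" "{i, b} \<in> A"
      by (auto simp: card_2_iff neighbors_def)
    obtain k where k: "k \<le> n" "i = x k"
      using \<open>i \<in> N\<close> N_eq by auto
    obtain l m where lm: "l \<le> n" "a = x l" "m \<le> n" "b = x m"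
      using nbr[of a i] nbr[of b i] ab by (auto simp: neighbors_def)
    \<comment> \<open>At most one of the distinct positions \<open>l\<close> and \<open>m\<close>
      equals \<open>Suc k\<close>, so one of the two factors is 0.\<close>
    have "l \<noteq> m"
      using ab(2) lm by auto
    then show "(\<Prod>j\<in>P. max (current g i j) 0) = 0"
      using ab k lm pos[of k l] pos[of k m] by auto
  qed
  ultimately show ?thesis
    using gc by (intro bexI[of _ g]) (simp_all add: total_objective_def)
qed

end

section \<open>Augmented graphs\<close>

lemma path_arcs_snoc:
  assumes "p \<noteq> []"
  shows "{last p, v} \<in> path_arcs (p @ [v])"
  unfolding path_arcs_def
  using assms by (auto simp: nth_append last_conv_nth intro!: exI[of _ "length p - 1"])

lemma path_arcs_Cons:
  assumes "p \<noteq> []"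
  shows "{v, hd p} \<in> path_arcs (v # p)"
  unfolding path_arcs_def
  using assms by (auto simp: hd_conv_nth intro!: exI[of _ 0])

lemma path_arcs_Cons_mono: "path_arcs p \<subseteq> path_arcs (v # p)"
proof
  fix a assume "a \<in> path_arcs p"
  then obtain k where "a = {(v # p) ! Suc k, (v # p) ! Suc (Suc k)}" "Suc (Suc k) < length (v # p)"
    by (auto simp: path_arcs_def)
  then show "a \<in> path_arcs (v # p)"
    unfolding path_arcs_def by blast
qed

lemma successively_arcs_mono:
  assumes "successively (\<lambda>i j. {i, j} \<in> A) p" "A \<subseteq> B"
  shows "successively (\<lambda>i j. {i, j} \<in> B) p"
  using assms(1) by (rule successively_mono) (use assms(2) in blast)

lemma hamiltonian_path_snoc:
  assumes "hamiltonian_path N A u w p" "v \<notin> N"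
  shows "hamiltonian_path (insert v N) (insert {w, v} A) u v (p @ [v])"
  using assms successively_arcs_mono[of A p "insert {w, v} A"]
  by (simp add: hamiltonian_path_def successively_append_iff subset_insertI)

lemma hamiltonian_path_Cons:
  assumes "hamiltonian_path N A u w p" "v \<notin> N"
  shows "hamiltonian_path (insert v N) (insert {v, u} A) v w (v # p)"
  using assms successively_arcs_mono[of A p "insert {v, u} A"]
  by (simp add: hamiltonian_path_def successively_Cons subset_insertI)

lemma augmentation_terminal_graph:
  assumes "augmentation N0 A0 hs he N A vin vout" "simple_graph N0 A0"
  shows "terminal_graph N A A0 vin vout"
  using assms(1)
proof cases
  case two
  then show ?thesis using assms(2) by unfold_locales auto
next
  case one
  then show ?thesis using assms(2) by unfold_locales (auto simp: simple_graph_def card_2_iff)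
next
  case none
  then show ?thesis using assms(2) by unfold_locales (auto simp: simple_graph_def card_2_iff)
qed

text \<open>Each added terminal hangs on an end of the given path, so extending the path by it
  traverses the added arc.\<close>

lemma augmentation_hamiltonian_path:
  assumes "augmentation N0 A0 hs he N A vin vout" and p: "hamiltonian_path N0 A0 hs he p"
  shows "\<exists>q. hamiltonian_path N A vin vout q \<and> A - A0 \<subseteq> path_arcs q"
  using assms(1)
proof cases
  case two
  then show ?thesis using p by auto
next
  case one
  have "{he, vout} \<in> path_arcs (p @ [vout])"
    using path_arcs_snoc[of p vout] p by (simp add: hamiltonian_path_def)
  moreover have "hamiltonian_path N A vin vout (p @ [vout])"
    using hamiltonian_path_snoc[OF p, of vout] one by simp
  ultimately show ?thesis using one by blast
next
  case none
  let ?q = "p @ [vout]"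
  have q: "hamiltonian_path (insert vout N0) (insert {he, vout} A0) hs vout ?q"
    using hamiltonian_path_snoc[OF p] none by simp
  have "{he, vout} \<in> path_arcs ?q"
    using path_arcs_snoc[of p vout] p by (simp add: hamiltonian_path_def)
  then have "{he, vout} \<in> path_arcs (vin # ?q)"
    by (rule subsetD[OF path_arcs_Cons_mono])
  moreover have "{vin, hs} \<in> path_arcs (vin # ?q)"
    using path_arcs_Cons[of ?q vin] q by (simp add: hamiltonian_path_def)
  moreover have "hamiltonian_path N A vin vout (vin # ?q)"
    using hamiltonian_path_Cons[OF q, of vin] none by (simp add: insert_commute)
  ultimately show ?thesis using none by blast
qed

section \<open>Global minimizers have objective 0\<close>

theorem theorem1:
  fixes N0 N :: "'a set" and A0 A :: "'a set set"
    and hstart hend vin vout :: 'a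
    and \<alpha>1 \<alpha>2 :: real and g :: "'a set \<Rightarrow> real"
  assumes "simple_graph N0 A0"
    and "connected_graph N0 A0"
    and "card N0 \<ge> 3"
    and "augmentation N0 A0 hstart hend N A vin vout"
    and "\<alpha>1 > 0" and "\<alpha>2 > 0"
    and "\<exists>p. hamiltonian_path N0 A0 hstart hend p"
    and "is_arg_min (circuit.total_objective N A A0 vin vout \<alpha>1 \<alpha>2)
           (\<lambda>g. g \<in> conductance_configs A0) g"
  shows "g \<in> circuit.hamiltonian_configs N A A0 vin vout"
proof -
  interpret terminal_graph N A A0 vin vout
    using assms(4,1) by (rule augmentation_terminal_graph)
  obtain p where "hamiltonian_path N0 A0 hstart hend p"
    using assms(7) by blast
  then obtain q where "hamiltonian_path N A vin vout q" "A - A0 \<subseteq> path_arcs q"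
    using augmentation_hamiltonian_path[OF assms(4)] by blast
  then obtain h where h: "h \<in> conductance_configs A0" "total_objective \<alpha>1 \<alpha>2 h = 0"
    using hamiltonian_path_objective_0 by blast
  have g: "g \<in> conductance_configs A0"
    and "\<not> total_objective \<alpha>1 \<alpha>2 h < total_objective \<alpha>1 \<alpha>2 g"
    using assms(8) h(1) by (auto simp: is_arg_min_def)
  \<comment> \<open>The minimum is at most the value 0 attained at \<open>h\<close>. As a sum of two
    nonnegative losses with positive weights, it forces both losses to vanish.\<close>
  then have "\<alpha>1 * outflow_loss g + \<alpha>2 * branch_loss g \<le> 0"
    using h(2) by (simp add: total_objective_def)
  moreover have "0 \<le> \<alpha>1 * outflow_loss g" "0 \<le> \<alpha>2 * branch_loss g"
    using assms(5,6) outflow_loss_nonneg branch_loss_nonneg by simp_all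
  ultimately have "\<alpha>1 * outflow_loss g = 0" "\<alpha>2 * branch_loss g = 0"
    by linarith+
  then have 0: "outflow_loss g = 0" "branch_loss g = 0"
    using assms(5,6) by simp_all
  have "branching g i = 0" if "i \<in> N" for i
    using 0(2) that by (simp add: branch_loss_def sum_nonneg_eq_0_iff finite_nodes branching_nonneg)
  then show ?thesis
    using vanishing_objective_hamiltonian g outflow_loss_eq_0[OF 0(1)] by blast
qed

end
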